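(* Let $T>0$ and let $\{X(t), t\in[0,T]\}$ be a real-valued stochastic process defined on a probability space $(\Omega,\mathcal{F},P)$. Suppose that there are constants $\alpha<0$, $\beta<0$ and $C>0$ such that $$E|X(t)-X(s)|^{\alpha}\le C|t-s|^{1+\beta}\qquad\text{for all } t,s\in[0,T],\ t\neq s .$$ Then for $P$-a.e. $\omega\in\Omega$ it holds that for each $\gamma>\beta/\alpha$ the path $t\mapsto X(t,\omega)$ is nowhere Hölder continuous of order $\gamma$.
   Context: A function $f:[0,T]\to\mathbb{R}$ is said to be $C^{\gamma}(t_0)$, for $t_0\in[0,T]$, if there is a constant $C>0$ such that $|f(t)-f(t_0)|\le C|t-t_0|^{\gamma}$ for all $t\in[0,T]$ in some neighbourhood of $t_0$. The function $f$ is nowhere Hölder continuous of order $\gamma$ if $f\notin C^{\gamma}(t_0)$ for every $t_0\in[0,T]$. For $\alpha<0$ one uses the convention $|0|^\alpha=+\infty$. "For $P$-a.e. $\omega$" means that the exceptional set of $\omega$ is contained in an event of probability zero. Standing assumption on all processes: they are measurable, separable, not a.s. constant, and stochastically continuous at zero, i.e. $P(|X(h)|>\varepsilon)\to 0$ as $h\to 0$ for every $\varepsilon>0$. *)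

theory Defs
  imports "HOL-Probability.Probability"
begin

definition holder_at :: "real \<Rightarrow> (real \<Rightarrow> real) \<Rightarrow> real \<Rightarrow> real \<Rightarrow> bool" where
  "holder_at T f \<gamma> t0 \<longleftrightarrow>
    (\<exists>C>0. \<exists>\<delta>>0. \<forall>t\<in>{0..T}. \<bar>t - t0\<bar> < \<delta> \<longrightarrow>
       \<bar>f t - f t0\<bar> \<le> C * \<bar>t - t0\<bar> powr \<gamma>)"

definition nowhere_holder :: "real \<Rightarrow> (real \<Rightarrow> real) \<Rightarrow> real \<Rightarrow> bool" where
  "nowhere_holder T f \<gamma> \<longleftrightarrow> (\<forall>t0\<in>{0..T}. \<not> holder_at T f \<gamma> t0)"

(* The library has 0 powr a = 0 for every a; for a negative exponent the
   convention here is that the power of 0 is infinite. Only a < 0 is used. *)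
definition neg_powr :: "real \<Rightarrow> real \<Rightarrow> ennreal" where
  "neg_powr x a = (if x = 0 then \<infinity> else ennreal (x powr a))"

definition measurable_process :: "'a measure \<Rightarrow> real \<Rightarrow> (real \<Rightarrow> 'a \<Rightarrow> real) \<Rightarrow> bool" where
  "measurable_process M T X \<longleftrightarrow>
    (\<lambda>(t, \<omega>). X t \<omega>) \<in> borel_measurable (restrict_space borel {0..T} \<Otimes>\<^sub>M M)"

(* Separability in the sense of Doob (relative to the closed sets), with separant S
   and exceptional null event N. The sets G \<inter> {0..T} with G open in the line are
   exactly the relatively open subsets of {0..T}. *)
definition separable_process :: "'a measure \<Rightarrow> real \<Rightarrow> (real \<Rightarrow> 'a \<Rightarrow> real) \<Rightarrow> bool" where
  "separable_process M T X \<longleftrightarrow>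
    (\<exists>S N. countable S \<and> S \<subseteq> {0..T} \<and> {0..T} \<subseteq> closure S \<and> N \<in> null_sets M \<and>
      (\<forall>G F. open G \<longrightarrow> closed F \<longrightarrow>
        (\<forall>\<omega>\<in>space M - N.
          (\<forall>t\<in>G \<inter> S. X t \<omega> \<in> F) \<longrightarrow> (\<forall>t\<in>G \<inter> {0..T}. X t \<omega> \<in> F))))"

definition as_constant :: "'a measure \<Rightarrow> real \<Rightarrow> (real \<Rightarrow> 'a \<Rightarrow> real) \<Rightarrow> bool" where
  "as_constant M T X \<longleftrightarrow> (AE \<omega> in M. \<exists>c. \<forall>t\<in>{0..T}. X t \<omega> = c)"

(* X h itself, not the increment X h - X 0, tends to 0 in probability. *)
definition stoch_continuous_at_zero ::
    "'a measure \<Rightarrow> real \<Rightarrow> (real \<Rightarrow> 'a \<Rightarrow> real) \<Rightarrow> bool" where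
  "stoch_continuous_at_zero M T X \<longleftrightarrow>
    (\<forall>\<epsilon>>0. ((\<lambda>h. measure M {\<omega> \<in> space M. \<bar>X h \<omega>\<bar> > \<epsilon>}) \<longlongrightarrow> 0) (at 0 within {0..T}))"

end

theory Submission imports Defs "HOL-Real_Asymp.Real_Asymp" begin

text \<open>
  The random energy \<open>Z = \<integral>\<integral> |X t - X s|\<^sup>\<alpha> |t - s|\<^sup>q dt ds\<close> over \<open>[0,T]\<^sup>2\<close>, with \<open>q = \<epsilon> - 2 - \<beta>\<close>, has
  finite expectation, because Tonelli and the moment bound reduce it to the integral of
  \<open>|t - s| powr (\<epsilon> - 1)\<close>. If a path is \<open>\<gamma>\<close>-Hoelder at a single point, then \<open>|X t - X s|\<close> is at most
  a multiple of \<open>r powr \<gamma>\<close> on a square of side \<open>r\<close> around that point, so that \<open>Z\<close> is at least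
  a multiple of \<open>r powr (\<gamma> * \<alpha> - \<beta> + \<epsilon>)\<close>. For \<open>\<gamma> > \<beta> / \<alpha>\<close> and small \<open>\<epsilon>\<close> this exponent is
  negative, and \<open>r \<rightarrow> 0\<close> gives \<open>Z = \<infinity>\<close>.
\<close>

definition path_energy :: "real \<Rightarrow> real \<Rightarrow> real \<Rightarrow> (real \<Rightarrow> real) \<Rightarrow> ennreal" where
  "path_energy T \<alpha> q f =
    (\<integral>\<^sup>+t\<in>{0..T}. (\<integral>\<^sup>+s\<in>{0..T}. neg_powr \<bar>f t - f s\<bar> \<alpha> * ennreal (\<bar>t - s\<bar> powr q) \<partial>lborel) \<partial>lborel)"

lemma measurable_neg_powr [measurable]: "(\<lambda>x. neg_powr x a) \<in> borel_measurable borel"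
  unfolding neg_powr_def by measurable

text \<open>A negative exponent reverses the order, and the infinite value at \<open>0\<close>
  covers the points where two path values coincide.\<close>

lemma neg_powr_ge:
  assumes "a < 0" "0 \<le> x" "x \<le> b"
  shows "ennreal (b powr a) \<le> neg_powr x a"
  using assms powr_mono2'[of a x b] by (auto simp: neg_powr_def intro: ennreal_leI)

text \<open>The quotient \<open>x / r\<close> lies in \<open>[1/3, 1]\<close>, where
  \<open>u powr q\<close> is monotone in \<open>u\<close>, so its minimum is attained at an
  endpoint.\<close>

lemma powr_rescaled_ge:
  fixes r x q :: real
  assumes "0 < r" "r / 3 \<le> x" "x \<le> r"
  shows "min 1 ((1/3) powr q) * r powr q \<le> x powr q"
proof -
  have "min 1 ((1/3) powr q) \<le> (x / r) powr q"
  proof (cases "q \<ge> 0")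
    case True
    have "(1/3) powr q \<le> (x / r) powr q"
      using True assms by (intro powr_mono2) (auto simp: field_simps)
    then show ?thesis by simp
  next
    case False
    have "1 powr q \<le> (x / r) powr q"
      using False assms by (intro powr_mono2') (auto simp: field_simps)
    then show ?thesis by simp
  qed
  moreover have "x powr q = (x / r) powr q * r powr q"
    using assms by (subst powr_mult[symmetric]) auto
  ultimately show ?thesis by (simp add: mult_right_mono)
qed

text \<open>Splitting at \<open>s = t\<close> and substituting the distance \<open>u\<close> leaves
  two pieces, each at most the integral of \<open>u powr (\<epsilon> - 1)\<close> over
  \<open>[0,T]\<close>, which converges at \<open>0\<close> because \<open>\<epsilon> > 0\<close>.
  The bound is uniform in \<open>t\<close>.\<close>

lemma nn_integral_powr_diff_le:
  assumes "\<epsilon> > 0" "T \<ge> 0" "t \<in> {0..T}"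
  shows "(\<integral>\<^sup>+s\<in>{0..T}. ennreal (\<bar>t - s\<bar> powr (\<epsilon> - 1)) \<partial>lborel) \<le> ennreal (2 * (T powr \<epsilon> / \<epsilon>))"
proof -
  \<comment> \<open>Extension by zero makes both pieces affine substitutions in one integral over
    the whole line.\<close>
  define h where "h u = indicator {0..T} u * u powr (\<epsilon> - 1)" for u :: real
  have [measurable]: "h \<in> borel_measurable borel"
    unfolding h_def by measurable
  have h_nonneg: "0 \<le> h u" for u
    by (simp add: h_def)
  have "((\<lambda>u. u powr (\<epsilon> - 1)) has_integral T powr \<epsilon> / \<epsilon>) {0..T}"
    using has_integral_powr_from_0[of "\<epsilon> - 1" T] assms by simp
  then have "((\<lambda>u. if u \<in> {0..T} then u powr (\<epsilon> - 1) else 0) has_integral T powr \<epsilon> / \<epsilon>) UNIV"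
    by (subst has_integral_restrict_UNIV)
  moreover have "(\<lambda>u. if u \<in> {0..T} then u powr (\<epsilon> - 1) else 0) = h"
    by (auto simp: h_def)
  ultimately have "(h has_integral T powr \<epsilon> / \<epsilon>) UNIV" by simp
  then have int_h: "(\<integral>\<^sup>+u. ennreal (h u) \<partial>lborel) = ennreal (T powr \<epsilon> / \<epsilon>)"
    using h_nonneg by (intro nn_integral_has_integral_lborel) auto
  have "(\<integral>\<^sup>+s\<in>{0..T}. ennreal (\<bar>t - s\<bar> powr (\<epsilon> - 1)) \<partial>lborel)
      \<le> (\<integral>\<^sup>+s. ennreal (h (t + (-1) * s)) + ennreal (h (- t + 1 * s)) \<partial>lborel)"
  proof (rule nn_integral_mono)
    fix s :: real
    have "\<bar>t - s\<bar> powr (\<epsilon> - 1) * indicator {0..T} s \<le> h (t + (-1) * s) + h (- t + 1 * s)"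
      using assms(3) by (cases "s \<le> t") (auto simp: h_def indicator_def)
    then show "ennreal (\<bar>t - s\<bar> powr (\<epsilon> - 1)) * indicator {0..T} s
        \<le> ennreal (h (t + (-1) * s)) + ennreal (h (- t + 1 * s))"
      using h_nonneg
      by (auto simp: indicator_def ennreal_plus[symmetric] simp del: ennreal_plus intro!: ennreal_leI)
  qed
  also have "\<dots> = (\<integral>\<^sup>+s. ennreal (h (t + (-1) * s)) \<partial>lborel) + (\<integral>\<^sup>+s. ennreal (h (- t + 1 * s)) \<partial>lborel)"
    by (rule nn_integral_add) measurable
  also have "\<dots> = ennreal (T powr \<epsilon> / \<epsilon>) + ennreal (T powr \<epsilon> / \<epsilon>)"
    using nn_integral_real_affine[of "\<lambda>u. ennreal (h u)" "-1" t]
      nn_integral_real_affine[of "\<lambda>u. ennreal (h u)" 1 "-t"]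
    by (simp add: int_h)
  also have "\<dots> = ennreal (2 * (T powr \<epsilon> / \<epsilon>))"
    using assms by (subst ennreal_plus[symmetric]) auto
  finally show ?thesis .
qed

text \<open>The integrand is at least a multiple of \<open>r powr (\<gamma> * \<alpha> + q)\<close>
  on a set of area \<open>r^2 / 9\<close> near \<open>t0\<close>, and the sign condition makes the
  product blow up as \<open>r\<close> tends to \<open>0\<close>. Only monotonicity of the integral
  enters, so \<open>f\<close> may be any function.\<close>

lemma path_energy_eq_top:
  assumes "T > 0" "\<alpha> < 0" "\<gamma> > 0" "\<gamma> * \<alpha> + q + 2 < 0"
    and t0: "t0 \<in> {0..T}" and "holder_at T f \<gamma> t0"
  shows "path_energy T \<alpha> q f = \<infinity>"
proof (rule ccontr)
  assume "path_energy T \<alpha> q f \<noteq> \<infinity>"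
  then obtain z where z: "path_energy T \<alpha> q f = ennreal z" "z \<ge> 0"
    by (cases "path_energy T \<alpha> q f") auto
  obtain K \<delta> where K: "K > 0" and \<delta>: "\<delta> > 0"
    and holder: "\<And>t. t \<in> {0..T} \<Longrightarrow> \<bar>t - t0\<bar> < \<delta> \<Longrightarrow> \<bar>f t - f t0\<bar> \<le> K * \<bar>t - t0\<bar> powr \<gamma>"
    using \<open>holder_at T f \<gamma> t0\<close> unfolding holder_at_def by blast
  define m where "m = min 1 ((1/3) powr q)"
  \<comment> \<open>The factor \<open>(2 * K) powr \<alpha>\<close> comes from the increments,
    \<open>m\<close> from the weight, and \<open>1 / 9\<close> from two intervals of length
    \<open>r / 3\<close>.\<close>
  define c where "c = (2 * K) powr \<alpha> * m / 9"
  have "m > 0" by (simp add: m_def)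
  then have "c > 0" using K by (simp add: c_def)
  have bound: "c * r powr (\<gamma> * \<alpha> + q + 2) \<le> z" if r: "0 < r" "r < \<delta>" "r \<le> T / 2" for r
  proof -
    \<comment> \<open>The window \<open>[a, a + r]\<close> has to stay in \<open>[0,T]\<close> even
      if \<open>t0\<close> is an endpoint. If \<open>t0 + r > T\<close>, then
      \<open>r \<le> T / 2\<close> gives \<open>t0 - r \<ge> 0\<close>.\<close>
    obtain a where a: "0 \<le> a" "a + r \<le> T" "a \<le> t0" "t0 \<le> a + r"
    proof (cases "t0 + r \<le> T")
      case True
      then show ?thesis using r t0 by (intro that[of t0]) auto
    next
      case False
      then show ?thesis using r t0 by (intro that[of "t0 - r"]) auto
    qed
    define L where "L = (2 * K * r powr \<gamma>) powr \<alpha> * (m * r powr q)"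
    have "L \<ge> 0" using \<open>m > 0\<close> by (simp add: L_def)
    \<comment> \<open>Separating \<open>t\<close> from \<open>s\<close> by \<open>r / 3\<close> makes the lower bound insensitive to the sign of \<open>q\<close>.\<close>
    let ?A = "{a .. a + r/3}" and ?B = "{a + 2*r/3 .. a + r}"
    have near: "\<bar>f t - f t0\<bar> \<le> K * r powr \<gamma>" if "t \<in> {a..a + r}" for t
    proof -
      have "\<bar>t - t0\<bar> \<le> r" "t \<in> {0..T}" using that a by auto
      then have "\<bar>f t - f t0\<bar> \<le> K * \<bar>t - t0\<bar> powr \<gamma>" using holder r by auto
      also have "\<dots> \<le> K * r powr \<gamma>"
        using K \<open>\<gamma> > 0\<close> \<open>\<bar>t - t0\<bar> \<le> r\<close> by (intro mult_left_mono powr_mono2) auto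
      finally show ?thesis .
    qed
    have pointwise: "ennreal L \<le> neg_powr \<bar>f t - f s\<bar> \<alpha> * ennreal (\<bar>t - s\<bar> powr q)"
      if "t \<in> ?A" "s \<in> ?B" for t s
    proof -
      have "\<bar>f t - f t0\<bar> \<le> K * r powr \<gamma>" "\<bar>f s - f t0\<bar> \<le> K * r powr \<gamma>"
        using that r by (auto intro!: near)
      \<comment> \<open>The triangle inequality through \<open>t0\<close> produces the factor
        2.\<close>
      then have "\<bar>f t - f s\<bar> \<le> 2 * K * r powr \<gamma>" by linarith
      then have "ennreal ((2 * K * r powr \<gamma>) powr \<alpha>) \<le> neg_powr \<bar>f t - f s\<bar> \<alpha>"
        using \<open>\<alpha> < 0\<close> by (intro neg_powr_ge) auto
      moreover have "m * r powr q \<le> \<bar>t - s\<bar> powr q"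
        unfolding m_def using that r by (intro powr_rescaled_ge) auto
      ultimately show ?thesis
        using \<open>m > 0\<close> unfolding L_def
        by (subst ennreal_mult) (auto intro!: mult_mono ennreal_leI)
    qed
    have len: "ennreal (r/3) = emeasure lborel ?A" "ennreal (r/3) = emeasure lborel ?B"
      using r by auto
    have "ennreal L * ennreal (r/3) * ennreal (r/3)
        = (\<integral>\<^sup>+t. (\<integral>\<^sup>+s. ennreal L * indicator ?B s \<partial>lborel) * indicator ?A t \<partial>lborel)"
      by (simp only: nn_integral_cmult_indicator sets_lborel atLeastAtMost_borel len[symmetric])
    also have "\<dots> \<le> path_energy T \<alpha> q f"
      unfolding path_energy_def
    proof (rule nn_integral_mono)
      fix t :: real
      show "(\<integral>\<^sup>+s. ennreal L * indicator ?B s \<partial>lborel) * indicator ?A t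
        \<le> (\<integral>\<^sup>+s\<in>{0..T}. neg_powr \<bar>f t - f s\<bar> \<alpha> * ennreal (\<bar>t - s\<bar> powr q) \<partial>lborel)
            * indicator {0..T} t"
      proof (cases "t \<in> ?A")
        case True
        have "(\<integral>\<^sup>+s. ennreal L * indicator ?B s \<partial>lborel)
            \<le> (\<integral>\<^sup>+s\<in>{0..T}. neg_powr \<bar>f t - f s\<bar> \<alpha> * ennreal (\<bar>t - s\<bar> powr q) \<partial>lborel)"
        proof (rule nn_integral_mono)
          fix s :: real
          show "ennreal L * indicator ?B s
              \<le> neg_powr \<bar>f t - f s\<bar> \<alpha> * ennreal (\<bar>t - s\<bar> powr q) * indicator {0..T} s"
          proof (cases "s \<in> ?B")
            case inB: True
            then have "s \<in> {0..T}" using a r by auto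
            then show ?thesis using pointwise[OF True inB] inB by simp
          qed simp
        qed
        moreover have "t \<in> {0..T}" using True a r by auto
        ultimately show ?thesis using True by simp
      qed simp
    qed
    finally have "ennreal (L * (r/3) * (r/3)) \<le> ennreal z"
      using z \<open>L \<ge> 0\<close> r by (simp add: ennreal_mult[symmetric])
    then have "L * (r/3) * (r/3) \<le> z" using z(2) by simp
    moreover have "L = (2 * K) powr \<alpha> * r powr (\<gamma> * \<alpha>) * m * r powr q"
      using K r by (simp add: L_def powr_mult powr_powr)
    moreover have "r powr (\<gamma> * \<alpha> + q + 2) = r powr (\<gamma> * \<alpha>) * r powr q * r ^ 2"
      using r by (simp add: powr_add)
    ultimately show ?thesis by (simp add: c_def power2_eq_square mult_ac)
  qed
  \<comment> \<open>Neither \<open>z\<close> nor \<open>c\<close> depends on \<open>r\<close>, so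
    divergence of the power contradicts \<open>bound\<close> for small \<open>r\<close>.\<close>
  have "filterlim (\<lambda>r. r powr (\<gamma> * \<alpha> + q + 2)) at_top (at_right 0)"
    using assms(4) by real_asymp
  then have "eventually (\<lambda>r. r powr (\<gamma> * \<alpha> + q + 2) > z / c) (at_right 0)"
    by (simp add: filterlim_at_top_dense)
  moreover have "eventually (\<lambda>r. r \<in> {0<..<min \<delta> (T/2)}) (at_right 0)"
    using \<delta> \<open>T > 0\<close> by (intro eventually_at_right_real) auto
  ultimately have "eventually (\<lambda>r::real. False) (at_right 0)"
  proof eventually_elim
    case (elim r)
    then have "c * r powr (\<gamma> * \<alpha> + q + 2) > z"
      using \<open>c > 0\<close> by (simp add: field_simps)
    moreover have "c * r powr (\<gamma> * \<alpha> + q + 2) \<le> z"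
      using elim by (intro bound) auto
    ultimately show False by simp
  qed
  then show False by simp
qed

text \<open>Joint measurability is given for times in \<open>[0,T]\<close>, while Tonelli is applied
  over the whole line. Clamping the time extends the process measurably and changes nothing on
  \<open>[0,T]\<close>.\<close>

lemma measurable_process_clamp:
  assumes "T \<ge> 0" "measurable_process M T X"
    and [measurable]: "g \<in> borel_measurable N" "h \<in> N \<rightarrow>\<^sub>M M"
  shows "(\<lambda>x. X (max 0 (min T (g x))) (h x)) \<in> borel_measurable N"
proof -
  have "(\<lambda>x. max 0 (min T (g x))) \<in> N \<rightarrow>\<^sub>M restrict_space borel {0..T}"
    using \<open>T \<ge> 0\<close> by (intro measurable_restrict_space2) auto
  then have "(\<lambda>x. (max 0 (min T (g x)), h x)) \<in> N \<rightarrow>\<^sub>M restrict_space borel {0..T} \<Otimes>\<^sub>M M"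
    by measurable
  from measurable_compose[OF this assms(2)[unfolded measurable_process_def]]
  show ?thesis by simp
qed

text \<open>The weight exponent is chosen so that
  \<open>(1 + \<beta>) + (\<epsilon> - 2 - \<beta>) = \<epsilon> - 1\<close>, which is integrable at
  the diagonal. The energy then has finite expectation.\<close>

lemma AE_path_energy_finite:
  fixes X :: "real \<Rightarrow> 'a \<Rightarrow> real"
  assumes "prob_space M" "T > 0" "measurable_process M T X" "\<epsilon> > 0" "C > 0"
    and moment: "\<And>t s. t \<in> {0..T} \<Longrightarrow> s \<in> {0..T} \<Longrightarrow> t \<noteq> s \<Longrightarrow>
           (\<integral>\<^sup>+\<omega>. neg_powr \<bar>X t \<omega> - X s \<omega>\<bar> \<alpha> \<partial>M) \<le> ennreal (C * \<bar>t - s\<bar> powr (1 + \<beta>))"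
  shows "AE \<omega> in M. path_energy T \<alpha> (\<epsilon> - 2 - \<beta>) (\<lambda>t. X t \<omega>) \<noteq> \<infinity>"
proof -
  interpret prob_space M by fact
  interpret L: pair_sigma_finite lborel M ..
  define Y where "Y t = X (max 0 (min T t))" for t
  have Y_eq: "Y t = X t" if "t \<in> {0..T}" for t
    using that by (simp add: Y_def)
  note [measurable] = measurable_process_clamp[OF less_imp_le[OF \<open>T > 0\<close>] assms(3), folded Y_def]
  have [measurable]: "Y t \<in> borel_measurable M" for t
    using measurable_process_clamp[of T M X "\<lambda>_. t" M "\<lambda>\<omega>. \<omega>"] assms(2,3) by (simp add: Y_def)
  \<comment> \<open>With the indicators inside the integrand, all time integrals run over the whole
    line and can be interchanged with the expectation.\<close>
  define W where "W \<omega> t s = neg_powr \<bar>Y t \<omega> - Y s \<omega>\<bar> \<alpha> * ennreal (\<bar>t - s\<bar> powr (\<epsilon> - 2 - \<beta>))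
      * indicator {0..T} s * indicator {0..T} t" for \<omega> t s
  have energy: "path_energy T \<alpha> (\<epsilon> - 2 - \<beta>) (\<lambda>t. X t \<omega>) = (\<integral>\<^sup>+t. \<integral>\<^sup>+s. W \<omega> t s \<partial>lborel \<partial>lborel)" for \<omega>
    unfolding path_energy_def W_def
    by (intro nn_integral_cong) (auto simp: indicator_def Y_eq intro!: nn_integral_cong)
  have inner: "(\<integral>\<^sup>+\<omega>. W \<omega> t s \<partial>M)
      \<le> ennreal C * (ennreal (\<bar>t - s\<bar> powr (\<epsilon> - 1)) * indicator {0..T} s) * indicator {0..T} t" for t s
  \<comment> \<open>On the diagonal the moment bound says nothing and \<open>neg_powr\<close> is
    infinite, but the weight \<open>0 powr (\<epsilon> - 2 - \<beta>)\<close> is \<open>0\<close>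
    and the product vanishes in \<open>ennreal\<close>.\<close>
  proof (cases "t \<in> {0..T} \<and> s \<in> {0..T} \<and> t \<noteq> s")
    case True
    then have "(\<integral>\<^sup>+\<omega>. W \<omega> t s \<partial>M)
        = (\<integral>\<^sup>+\<omega>. neg_powr \<bar>Y t \<omega> - Y s \<omega>\<bar> \<alpha> * ennreal (\<bar>t - s\<bar> powr (\<epsilon> - 2 - \<beta>)) \<partial>M)"
      by (simp add: W_def)
    also have "\<dots> = (\<integral>\<^sup>+\<omega>. neg_powr \<bar>Y t \<omega> - Y s \<omega>\<bar> \<alpha> \<partial>M) * ennreal (\<bar>t - s\<bar> powr (\<epsilon> - 2 - \<beta>))"
      by (rule nn_integral_multc) measurable
    also have "\<dots> = (\<integral>\<^sup>+\<omega>. neg_powr \<bar>X t \<omega> - X s \<omega>\<bar> \<alpha> \<partial>M) * ennreal (\<bar>t - s\<bar> powr (\<epsilon> - 2 - \<beta>))"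
      using True by (simp add: Y_eq)
    also have "\<dots> \<le> ennreal (C * \<bar>t - s\<bar> powr (1 + \<beta>)) * ennreal (\<bar>t - s\<bar> powr (\<epsilon> - 2 - \<beta>))"
      using True by (intro mult_right_mono moment) auto
    also have "\<dots> = ennreal (C * (\<bar>t - s\<bar> powr (1 + \<beta>) * \<bar>t - s\<bar> powr (\<epsilon> - 2 - \<beta>)))"
      using \<open>C > 0\<close> by (simp add: ennreal_mult[symmetric] mult.assoc)
    also have "\<bar>t - s\<bar> powr (1 + \<beta>) * \<bar>t - s\<bar> powr (\<epsilon> - 2 - \<beta>) = \<bar>t - s\<bar> powr (\<epsilon> - 1)"
      by (simp add: powr_add[symmetric])
    finally show ?thesis using True \<open>C > 0\<close> by (simp add: ennreal_mult)
  qed (auto simp: W_def)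
  \<comment> \<open>Two interchanges move the expectation innermost, where \<open>inner\<close>
    applies.\<close>
  have "(\<integral>\<^sup>+\<omega>. \<integral>\<^sup>+t. \<integral>\<^sup>+s. W \<omega> t s \<partial>lborel \<partial>lborel \<partial>M) = (\<integral>\<^sup>+t. \<integral>\<^sup>+\<omega>. \<integral>\<^sup>+s. W \<omega> t s \<partial>lborel \<partial>M \<partial>lborel)"
    by (rule L.Fubini') (unfold W_def, measurable)
  also have "\<dots> = (\<integral>\<^sup>+t. \<integral>\<^sup>+s. \<integral>\<^sup>+\<omega>. W \<omega> t s \<partial>M \<partial>lborel \<partial>lborel)"
    by (intro nn_integral_cong L.Fubini') (unfold W_def, measurable)
  also have "\<dots> \<le> (\<integral>\<^sup>+t. \<integral>\<^sup>+s. ennreal C * (ennreal (\<bar>t - s\<bar> powr (\<epsilon> - 1)) * indicator {0..T} s)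
      * indicator {0..T} t \<partial>lborel \<partial>lborel)"
    by (intro nn_integral_mono inner)
  also have "\<dots> = (\<integral>\<^sup>+t. ennreal C * (\<integral>\<^sup>+s\<in>{0..T}. ennreal (\<bar>t - s\<bar> powr (\<epsilon> - 1)) \<partial>lborel)
      * indicator {0..T} t \<partial>lborel)"
    by (simp add: nn_integral_multc nn_integral_cmult)
  also have "\<dots> \<le> (\<integral>\<^sup>+t. ennreal C * ennreal (2 * (T powr \<epsilon> / \<epsilon>)) * indicator {0..T} t \<partial>lborel)"
    using nn_integral_powr_diff_le[of \<epsilon> T] assms(2,4)
    by (intro nn_integral_mono) (auto simp: indicator_def intro!: mult_left_mono)
  also have "\<dots> = ennreal C * ennreal (2 * (T powr \<epsilon> / \<epsilon>)) * ennreal T"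
    using \<open>T > 0\<close> by (subst nn_integral_cmult_indicator) auto
  also have "\<dots> < \<infinity>"
    by (simp add: ennreal_mult_less_top)
  finally have "(\<integral>\<^sup>+\<omega>. \<integral>\<^sup>+t. \<integral>\<^sup>+s. W \<omega> t s \<partial>lborel \<partial>lborel \<partial>M) \<noteq> \<infinity>" by simp
  then show ?thesis
    unfolding energy by (intro nn_integral_PInf_AE) (unfold W_def, measurable)
qed

theorem theorem2:
  fixes M :: "'a measure" and X :: "real \<Rightarrow> 'a \<Rightarrow> real" and T \<alpha> \<beta> C :: real
  assumes "prob_space M"
    and "T > 0"
    and "\<And>t. t \<in> {0..T} \<Longrightarrow> X t \<in> borel_measurable M"
    and "measurable_process M T X"
    and "separable_process M T X"
    and "\<not> as_constant M T X"
    and "stoch_continuous_at_zero M T X"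
    and "\<alpha> < 0" and "\<beta> < 0" and "C > 0"
    and "\<And>t s. t \<in> {0..T} \<Longrightarrow> s \<in> {0..T} \<Longrightarrow> t \<noteq> s \<Longrightarrow>
           (\<integral>\<^sup>+\<omega>. neg_powr \<bar>X t \<omega> - X s \<omega>\<bar> \<alpha> \<partial>M) \<le> ennreal (C * \<bar>t - s\<bar> powr (1 + \<beta>))"
  shows "AE \<omega> in M. \<forall>\<gamma>. \<gamma> > \<beta> / \<alpha> \<longrightarrow> nowhere_holder T (\<lambda>t. X t \<omega>) \<gamma>"
proof -
  \<comment> \<open>Letting \<open>\<epsilon>\<close> run through the countable family
    \<open>1 / (n + 1)\<close> yields one null set that serves all \<open>\<gamma>\<close> at
    once.\<close>
  have "AE \<omega> in M. \<forall>n. path_energy T \<alpha> (inverse (real (Suc n)) - 2 - \<beta>) (\<lambda>t. X t \<omega>) \<noteq> \<infinity>"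
    unfolding AE_all_countable using assms
    by (intro allI AE_path_energy_finite[where C = C]) auto
  then show ?thesis
  proof (rule AE_mp, intro AE_I2 impI allI)
    fix \<omega> \<gamma>
    assume finite: "\<forall>n. path_energy T \<alpha> (inverse (real (Suc n)) - 2 - \<beta>) (\<lambda>t. X t \<omega>) \<noteq> \<infinity>"
      and \<gamma>: "\<gamma> > \<beta> / \<alpha>"
    have "\<gamma> > 0"
      using \<gamma> divide_neg_neg[OF \<open>\<beta> < 0\<close> \<open>\<alpha> < 0\<close>] by linarith
    \<comment> \<open>Multiplying by the negative \<open>\<alpha>\<close> reverses the inequality.
      Any \<open>\<epsilon>\<close> below this gap satisfies the divergence condition of
      \<open>path_energy_eq_top\<close>.\<close>
    have "\<beta> - \<gamma> * \<alpha> > 0"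
      using \<gamma> \<open>\<alpha> < 0\<close> by (simp add: neg_divide_less_eq)
    then obtain n where "inverse (real (Suc n)) < \<beta> - \<gamma> * \<alpha>"
      using reals_Archimedean by blast
    then have "\<gamma> * \<alpha> + (inverse (real (Suc n)) - 2 - \<beta>) + 2 < 0" by linarith
    then show "nowhere_holder T (\<lambda>t. X t \<omega>) \<gamma>"
      using path_energy_eq_top[of T \<alpha> \<gamma> "inverse (real (Suc n)) - 2 - \<beta>"] finite
        \<open>T > 0\<close> \<open>\<alpha> < 0\<close> \<open>\<gamma> > 0\<close>
      unfolding nowhere_holder_def by blast
  qed
qed

end
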